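(* Let $\alpha_1, A_1, \alpha_2, \gamma_2 > 0$ and consider the system of difference equations $$x_{n+1}=\frac{\alpha_{1}}{A_{1}+y_{n}},\qquad y_{n+1}=\alpha_{2}+\gamma_{2}y_{n},\qquad n=0,1,2,\dots,$$ with arbitrary nonnegative initial conditions $x_0,y_0$. (1) If $\gamma_{2}<1$, then there is a unique equilibrium, namely $$\left(\frac{\alpha_{1}-\alpha_{1}\gamma_{2}}{A_{1}-A_{1}\gamma_{2}+\alpha_{2}},\frac{\alpha_{2}}{1-\gamma_{2}}\right),$$ and it is globally asymptotically stable. (2) If $\gamma_{2}\geq 1$, then for an arbitrary choice of initial conditions $\lim_{n\rightarrow\infty}(x_{n},y_{n})=(0,\infty)$.
   Context: The state space is $[0,\infty)^2$. An equilibrium is a point $(\bar x,\bar y)\in[0,\infty)^2$ such that the constant sequence $(x_n,y_n)=(\bar x,\bar y)$ solves the system. It is globally asymptotically stable if it is Lyapunov stable relative to $[0,\infty)^2$ (for every $\varepsilon>0$ there is $\delta>0$ such that every initial condition in $[0,\infty)^2$ within $\delta$ of $(\bar x,\bar y)$ has its whole orbit within $\varepsilon$ of $(\bar x,\bar y)$) and every solution with initial condition in $[0,\infty)^2$ converges to $(\bar x,\bar y)$. The notation $\lim_{n\to\infty}(x_n,y_n)=(0,\infty)$ means $x_n\to 0$ and $y_n\to\infty$. *)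

theory Defs
  imports "HOL-Analysis.Analysis"
begin

definition state_space :: "(real \<times> real) set" where
  "state_space = {0..} \<times> {0..}"

text \<open>
  A solution of the first-order system \<open>z\<^sub>n\<^sub>+\<^sub>1 = F z\<^sub>n\<close>. Only the initial condition is
  required to be nonnegative.
\<close>
definition solution :: "(real \<times> real \<Rightarrow> real \<times> real) \<Rightarrow> (nat \<Rightarrow> real \<times> real) \<Rightarrow> bool" where
  "solution F z \<longleftrightarrow> z 0 \<in> state_space \<and> (\<forall>n. z (Suc n) = F (z n))"

definition equilibrium :: "(real \<times> real \<Rightarrow> real \<times> real) \<Rightarrow> real \<times> real \<Rightarrow> bool" where
  "equilibrium F p \<longleftrightarrow> p \<in> state_space \<and> solution F (\<lambda>n. p)"

text \<open>
  Stability is relative to the state space: perturbed initial conditions range over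
  \<open>state_space\<close> (through \<open>solution\<close>), not over a full neighbourhood of \<open>p\<close>. The
  distance is the Euclidean one on pairs.
\<close>
definition lyapunov_stable :: "(real \<times> real \<Rightarrow> real \<times> real) \<Rightarrow> real \<times> real \<Rightarrow> bool" where
  "lyapunov_stable F p \<longleftrightarrow>
     (\<forall>\<epsilon>>0. \<exists>\<delta>>0. \<forall>z. solution F z \<and> dist (z 0) p < \<delta> \<longrightarrow> (\<forall>n. dist (z n) p < \<epsilon>))"

definition globally_asymptotically_stable ::
    "(real \<times> real \<Rightarrow> real \<times> real) \<Rightarrow> real \<times> real \<Rightarrow> bool" where
  "globally_asymptotically_stable F p \<longleftrightarrow>
     equilibrium F p \<and> lyapunov_stable F p \<and> (\<forall>z. solution F z \<longrightarrow> z \<longlonglongrightarrow> p)"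

definition rational_system :: "real \<Rightarrow> real \<Rightarrow> real \<Rightarrow> real \<Rightarrow> real \<times> real \<Rightarrow> real \<times> real" where
  "rational_system \<alpha>\<^sub>1 A\<^sub>1 \<alpha>\<^sub>2 \<gamma>\<^sub>2 = (\<lambda>(x, y). (\<alpha>\<^sub>1 / (A\<^sub>1 + y), \<alpha>\<^sub>2 + \<gamma>\<^sub>2 * y))"

end

theory Submission
  imports Defs
begin

text \<open>
  The second coordinate evolves on its own by the affine map \<open>y \<mapsto> \<alpha>\<^sub>2 + \<gamma>\<^sub>2 y\<close>, and the first one is
  a function of the previous second one that is Lipschitz on \<open>[0,\<infinity>)\<close> with constant \<open>\<alpha>\<^sub>1 / A\<^sub>1\<^sup>2\<close>.
  If \<open>\<gamma>\<^sub>2 < 1\<close>, the distance to the equilibrium after \<open>n + 1\<close> steps is therefore at most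
  \<open>(\<alpha>\<^sub>1 / A\<^sub>1\<^sup>2 + 1) \<gamma>\<^sub>2\<^sup>n\<close> times the initial distance, which gives both stability and attraction.
  If \<open>\<gamma>\<^sub>2 \<ge> 1\<close>, then \<open>y\<^sub>n \<ge> n \<alpha>\<^sub>2\<close>.
\<close>

lemma solution_Suc:
  assumes "solution (rational_system a A b g) z"
  shows "fst (z (Suc n)) = a / (A + snd (z n))" "snd (z (Suc n)) = b + g * snd (z n)"
  using assms by (simp_all add: solution_def rational_system_def split_beta)

text \<open>Only the second coordinate is fed back into the recursion, so its sign alone controls
  the denominators \<open>A + y\<close>.\<close>

lemma solution_snd_nonneg:
  assumes "solution (rational_system a A b g) z" "b \<ge> 0" "g \<ge> 0"
  shows "snd (z n) \<ge> 0"
proof (induction n)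
  case 0
  then show ?case
    using assms(1) by (auto simp: solution_def state_space_def)
next
  case (Suc n)
  then show ?case
    using assms by (simp add: solution_Suc)
qed

text \<open>Over a common denominator the difference has numerator \<open>a * (w - y)\<close>, and
  both factors of the denominator are at least \<open>A\<close>.\<close>

lemma dist_divide_add_le:
  fixes a A y w :: real
  assumes "a \<ge> 0" "A > 0" "y \<ge> 0" "w \<ge> 0"
  shows "dist (a / (A + y)) (a / (A + w)) \<le> a / A\<^sup>2 * dist y w"
proof -
  have "a / (A + y) - a / (A + w) = a * (w - y) / ((A + y) * (A + w))"
    using assms by (simp add: diff_frac_eq algebra_simps)
  hence "dist (a / (A + y)) (a / (A + w)) = a * \<bar>w - y\<bar> / ((A + y) * (A + w))"
    using assms by (simp add: dist_real_def abs_mult)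
  also have "\<dots> \<le> a * \<bar>w - y\<bar> / (A * A)"
    using assms by (intro divide_left_mono mult_mono mult_pos_pos) auto
  finally show ?thesis
    by (simp add: dist_real_def power2_eq_square abs_minus_commute)
qed

lemma equilibrium_rational_system_iff:
  fixes a A b g :: real
  assumes "a > 0" "A > 0" "b > 0" "g < 1"
  shows "equilibrium (rational_system a A b g) q \<longleftrightarrow>
           q = ((a - a * g) / (A - A * g + b), b / (1 - g))"
proof -
  obtain x y where q: "q = (x, y)"
    by (cases q)
  have y_iff: "y = b + g * y \<longleftrightarrow> y = b / (1 - g)"
    using assms by (auto simp: field_simps)
  \<comment> \<open>Substituting the fixed point of the affine map into \<open>a / (A + y)\<close>
    leaves a compound fraction; clearing \<open>1 - g\<close> gives the closed form of the first
    coordinate.\<close>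
  have "A + b / (1 - g) = (A - A * g + b) / (1 - g)"
    using assms by (simp add: field_simps)
  hence x_eq: "a / (A + b / (1 - g)) = (a - a * g) / (A - A * g + b)"
    by (simp add: algebra_simps)
  have "a / (A + b / (1 - g)) \<ge> 0" "b / (1 - g) \<ge> 0"
    using assms by simp_all
  thus ?thesis
    unfolding q equilibrium_def solution_def state_space_def rational_system_def
    using y_iff x_eq by auto
qed

text \<open>The exponent lags the index by one because the new first coordinate depends on the
  previous second one. The initial first coordinate is forgotten after one step.\<close>

lemma dist_solution_equilibrium:
  assumes sol: "solution (rational_system a A b g) z"
    and eq: "equilibrium (rational_system a A b g) q"
    and pos: "a \<ge> 0" "A > 0" "b \<ge> 0" "g \<ge> 0" "g \<le> 1"
  shows "dist (z (Suc n)) q \<le> (a / A\<^sup>2 + 1) * g ^ n * dist (z 0) q"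
proof -
  \<comment> \<open>As a constant solution, \<open>q\<close> obeys the same recurrences as
    \<open>z\<close>, so the two can be subtracted.\<close>
  have q: "solution (rational_system a A b g) (\<lambda>n. q)"
    using eq by (simp add: equilibrium_def)
  have step: "dist (snd (z (Suc k))) (snd q) = g * dist (snd (z k)) (snd q)" for k
  proof -
    have "snd (z (Suc k)) - snd q = g * (snd (z k) - snd q)"
      using solution_Suc(2)[OF sol] solution_Suc(2)[OF q] by (simp add: algebra_simps)
    thus ?thesis
      using pos by (simp add: dist_real_def abs_mult)
  qed
  have snd_dist: "dist (snd (z k)) (snd q) = g ^ k * dist (snd (z 0)) (snd q)" for k
    by (induction k) (simp_all add: step)
  have le: "dist (snd (z n)) (snd q) \<le> g ^ n * dist (z 0) q"
    using pos by (simp add: snd_dist[of n] mult_left_mono dist_snd_le)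
  have "dist (fst (z (Suc n))) (fst q) = dist (a / (A + snd (z n))) (a / (A + snd q))"
    using solution_Suc(1)[OF sol] solution_Suc(1)[OF q] by simp
  also have "\<dots> \<le> a / A\<^sup>2 * dist (snd (z n)) (snd q)"
    using pos solution_snd_nonneg[OF sol] solution_snd_nonneg[OF q]
    by (intro dist_divide_add_le) auto
  finally have x: "dist (fst (z (Suc n))) (fst q) \<le> a / A\<^sup>2 * dist (snd (z n)) (snd q)" .
  \<comment> \<open>Giving up one factor \<open>g\<close> measures both coordinates by the same
    quantity; this is the summand 1 in the constant.\<close>
  have y: "dist (snd (z (Suc n))) (snd q) \<le> dist (snd (z n)) (snd q)"
    using pos by (simp add: step mult_left_le_one_le)
  have "dist (z (Suc n)) q \<le> dist (fst (z (Suc n))) (fst q) + dist (snd (z (Suc n))) (snd q)"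
    by (simp add: dist_prod_def sqrt_sum_squares_le_sum)
  also have "\<dots> \<le> (a / A\<^sup>2 + 1) * dist (snd (z n)) (snd q)"
    using x y by (simp add: distrib_right)
  also have "\<dots> \<le> (a / A\<^sup>2 + 1) * (g ^ n * dist (z 0) q)"
    using pos le by (intro mult_left_mono) auto
  finally show ?thesis
    by (simp add: mult.assoc)
qed

lemma globally_asymptotically_stable_rational_system:
  assumes eq: "equilibrium (rational_system a A b g) q"
    and pos: "a \<ge> 0" "A > 0" "b \<ge> 0" "g \<ge> 0" "g < 1"
  shows "globally_asymptotically_stable (rational_system a A b g) q"
proof -
  define K where "K = a / A\<^sup>2 + 1"
  have K: "K \<ge> 1"
    using pos by (simp add: K_def)
  have bound: "dist (z (Suc n)) q \<le> K * g ^ n * dist (z 0) q"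
    if "solution (rational_system a A b g) z" for z n
    using dist_solution_equilibrium[OF that eq] pos by (simp add: K_def)
  have "lyapunov_stable (rational_system a A b g) q"
    unfolding lyapunov_stable_def
  proof (intro allI impI)
    fix e :: real
    assume "e > 0"
    show "\<exists>d>0. \<forall>z. solution (rational_system a A b g) z \<and> dist (z 0) q < d \<longrightarrow>
            (\<forall>n. dist (z n) q < e)"
    \<comment> \<open>Since \<open>g ^ m \<le> 1\<close>, no orbit gets farther from
      \<open>q\<close> than \<open>K\<close> times its initial distance. Index 0 lies outside
      \<open>bound\<close> and is covered by \<open>K \<ge> 1\<close>.\<close>
    proof (intro exI[of _ "e / K"] conjI allI impI)
      show "e / K > 0"
        using \<open>e > 0\<close> K by simp
    next
      fix z n
      assume z: "solution (rational_system a A b g) z \<and> dist (z 0) q < e / K"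
      hence Kd: "K * dist (z 0) q < e"
        using K by (simp add: field_simps)
      have "dist (z n) q \<le> K * dist (z 0) q"
      proof (cases n)
        case 0
        then show ?thesis
          using mult_right_mono[OF K, of "dist (z 0) q"] by simp
      next
        case (Suc m)
        have "g ^ m \<le> 1"
          using pos by (simp add: power_le_one)
        hence "K * g ^ m * dist (z 0) q \<le> K * 1 * dist (z 0) q"
          using K by (intro mult_right_mono mult_left_mono) auto
        then show ?thesis
          using bound[of z m] z Suc by simp
      qed
      with Kd show "dist (z n) q < e"
        by simp
    qed
  qed
  moreover have "z \<longlonglongrightarrow> q" if sol: "solution (rational_system a A b g) z" for z
  proof -
    have "(\<lambda>n. g ^ n) \<longlonglongrightarrow> 0"
      using pos by (intro LIMSEQ_power_zero) simp
    from tendsto_mult_right[OF tendsto_mult_left[OF this, of K], of "dist (z 0) q"]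
    have "(\<lambda>n. K * g ^ n * dist (z 0) q) \<longlonglongrightarrow> 0"
      by simp
    hence "(\<lambda>n. dist (z (Suc n)) q) \<longlonglongrightarrow> 0"
      \<comment> \<open>The lower bound is the constant 0; the rotation puts the limit of the upper
        bound first, where the chained fact is matched.\<close>
      by (rule tendsto_sandwich[OF _ _ tendsto_const, rotated 2])
        (use bound[OF sol] in auto)
    thus ?thesis
      using filterlim_sequentially_Suc[of z] tendsto_dist_iff[of "\<lambda>n. z (Suc n)" q] by blast
  qed
  ultimately show ?thesis
    using eq by (simp add: globally_asymptotically_stable_def)
qed

text \<open>For \<open>g \<ge> 1\<close> a nonnegative second coordinate gains at least
  \<open>b\<close> per step. This linear bound also covers \<open>g = 1\<close>, where growth is not
  geometric.\<close>

lemma solution_snd_at_top: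
  assumes sol: "solution (rational_system a A b g) z" and pos: "b > 0" "g \<ge> 1"
  shows "filterlim (\<lambda>n. snd (z n)) at_top sequentially"
proof -
  have nonneg: "snd (z n) \<ge> 0" for n
    using solution_snd_nonneg[OF sol] pos by simp
  have "snd (z n) \<ge> b * real n" for n
  proof (induction n)
    case 0
    then show ?case
      using nonneg by simp
  next
    case (Suc n)
    have "snd (z n) \<le> g * snd (z n)"
      using mult_right_mono[OF pos(2) nonneg[of n]] by simp
    with Suc show ?case
      by (simp add: solution_Suc[OF sol] algebra_simps)
  qed
  moreover have "filterlim (\<lambda>n. b * real n) at_top sequentially"
    using pos filterlim_tendsto_pos_mult_at_top[OF tendsto_const _ filterlim_real_sequentially]
    by blast
  ultimately show ?thesis
    by (auto intro: filterlim_at_top_mono)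
qed

text \<open>The numerator is fixed while the denominator diverges. The formula holds only from index
  1 on, so the limit is taken for the shifted sequence first.\<close>

lemma solution_fst_tendsto_0:
  assumes sol: "solution (rational_system a A b g) z" and pos: "b > 0" "g \<ge> 1"
  shows "(\<lambda>n. fst (z n)) \<longlonglongrightarrow> 0"
proof -
  have "filterlim (\<lambda>n. A + snd (z n)) at_top sequentially"
    using solution_snd_at_top[OF sol pos]
    by (rule filterlim_tendsto_add_at_top[OF tendsto_const])
  hence "(\<lambda>n. a / (A + snd (z n))) \<longlonglongrightarrow> 0"
    by (intro tendsto_divide_0[OF tendsto_const] filterlim_at_top_imp_at_infinity)
  hence "(\<lambda>n. fst (z (Suc n))) \<longlonglongrightarrow> 0"
    by (simp add: solution_Suc[OF sol])
  thus ?thesis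
    by (rule LIMSEQ_imp_Suc)
qed

theorem theorem12:
  fixes \<alpha>\<^sub>1 A\<^sub>1 \<alpha>\<^sub>2 \<gamma>\<^sub>2 :: real
  assumes "\<alpha>\<^sub>1 > 0" and "A\<^sub>1 > 0" and "\<alpha>\<^sub>2 > 0" and "\<gamma>\<^sub>2 > 0"
  defines "F \<equiv> rational_system \<alpha>\<^sub>1 A\<^sub>1 \<alpha>\<^sub>2 \<gamma>\<^sub>2"
  defines "p \<equiv> ((\<alpha>\<^sub>1 - \<alpha>\<^sub>1 * \<gamma>\<^sub>2) / (A\<^sub>1 - A\<^sub>1 * \<gamma>\<^sub>2 + \<alpha>\<^sub>2), \<alpha>\<^sub>2 / (1 - \<gamma>\<^sub>2))"
  shows "(\<gamma>\<^sub>2 < 1 \<longrightarrow>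
            (\<forall>q. equilibrium F q \<longleftrightarrow> q = p) \<and> globally_asymptotically_stable F p) \<and>
         (\<gamma>\<^sub>2 \<ge> 1 \<longrightarrow>
            (\<forall>z. solution F z \<longrightarrow>
               (\<lambda>n. fst (z n)) \<longlonglongrightarrow> 0 \<and> filterlim (\<lambda>n. snd (z n)) at_top sequentially))"
proof (intro conjI impI)
  assume g: "\<gamma>\<^sub>2 < 1"
  show unique: "\<forall>q. equilibrium F q \<longleftrightarrow> q = p"
    unfolding F_def p_def using equilibrium_rational_system_iff[OF assms(1-3) g] by blast
  hence "equilibrium F p"
    by blast
  thus "globally_asymptotically_stable F p"
    unfolding F_def
    by (rule globally_asymptotically_stable_rational_system) (use assms(1-4) g in simp_all)
next
  assume g: "\<gamma>\<^sub>2 \<ge> 1"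
  show "\<forall>z. solution F z \<longrightarrow>
      (\<lambda>n. fst (z n)) \<longlonglongrightarrow> 0 \<and> filterlim (\<lambda>n. snd (z n)) at_top sequentially"
    unfolding F_def
    using solution_fst_tendsto_0[OF _ assms(3) g] solution_snd_at_top[OF _ assms(3) g] by blast
qed

end
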